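(* Let $X$ be an exterior space that is locally path-connected and first countable at infinity. Then $\check C_0(X)$ is $\check C_0$-complete.
   Context: Exterior spaces: an exterior space is a topological space $X$ together with a nonempty family $\varepsilon(X)$ of open subsets (an externology; its members are called exterior open subsets) closed under finite intersections and such that if $E\in\varepsilon(X)$, $U$ is open and $E\subset U$, then $U\in\varepsilon(X)$. A map between exterior spaces is exterior if it is continuous and preimages of exterior open subsets are exterior open. $\mathbf E$ is the category of exterior spaces and exterior maps. $X$ is first countable at infinity if $\varepsilon(X)$ has a countable base $E_0\supset E_1\supset E_2\supset\cdots$, i.e. $E_n\in\varepsilon(X)$ and every $E\in\varepsilon(X)$ contains some $E_n$. Limit and end spaces: for a space $Y$, $\pi_0(Y)$ is the set of path-components with the quotient topology of $q_0\colon Y\to\pi_0(Y)$. $L(X)=\bigcap_{E\in\varepsilon(X)}E$ (subspace topology); $\check\pi_0(X)=\lim_{E\in\varepsilon(X)}\pi_0(E)$ (inverse limit topology), with projections $\eta_{0,E}\colon\check\pi_0(X)\to\pi_0(E)$; $e_0\colon L(X)\to\check\pi_0(X)$ sends $x$ to the family of path-components of $x$ in the sets $E$. Completion: $\check C_0(X)$ has underlying set the push-out $X\cup_{L(X)}\check\pi_0(X)$ of the inclusion $L(X)\to X$ and $e_0$, with canonical maps $p_0\colon X\to\check C_0(X)$, $\operatorname{in}_0\colon\check\pi_0(X)\to\check C_0(X)$. A subset $W$ is open iff (i) $p_0^{-1}(W)$ and $\operatorname{in}_0^{-1}(W)$ are open, and (ii) for each $a\in\operatorname{in}_0^{-1}(W)$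 there are $E\in\varepsilon(X)$ and an open $G\subset\pi_0(E)$ with $a\in\eta_{0,E}^{-1}(G)\subset\operatorname{in}_0^{-1}(W)$ and $q_0^{-1}(G)\subset p_0^{-1}(W)$. Its externology is $\{W_0(E): E\in\varepsilon(X)\}$ with $W_0(E)=p_0(E)\cup\operatorname{in}_0(\check\pi_0(X))$. An exterior space $X$ is $\check C_0$-complete if $p_0\colon X\to\check C_0(X)$ is an isomorphism in $\mathbf E$. *)

theory Defs
  imports "HOL-Analysis.Analysis"
begin

section \<open>Exterior spaces\<close>

text \<open>An exterior space is given by a topology together with its externology.\<close>

definition exterior_space :: "'a topology \<Rightarrow> 'a set set \<Rightarrow> bool" where
  "exterior_space X \<epsilon> \<longleftrightarrow>
     \<epsilon> \<noteq> {} \<and>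
     (\<forall>E\<in>\<epsilon>. openin X E) \<and>
     (\<forall>E\<in>\<epsilon>. \<forall>F\<in>\<epsilon>. E \<inter> F \<in> \<epsilon>) \<and>
     (\<forall>E\<in>\<epsilon>. \<forall>U. openin X U \<and> E \<subseteq> U \<longrightarrow> U \<in> \<epsilon>)"

definition exterior_map ::
  "'a topology \<Rightarrow> 'a set set \<Rightarrow> 'b topology \<Rightarrow> 'b set set \<Rightarrow> ('a \<Rightarrow> 'b) \<Rightarrow> bool" where
  "exterior_map X \<epsilon> Y \<delta> f \<longleftrightarrow>
     continuous_map X Y f \<and> (\<forall>E\<in>\<delta>. {x \<in> topspace X. f x \<in> E} \<in> \<epsilon>)"

definition exterior_isomorphism ::
  "'a topology \<Rightarrow> 'a set set \<Rightarrow> 'b topology \<Rightarrow> 'b set set \<Rightarrow> ('a \<Rightarrow> 'b) \<Rightarrow> bool" where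
  "exterior_isomorphism X \<epsilon> Y \<delta> f \<longleftrightarrow>
     exterior_map X \<epsilon> Y \<delta> f \<and>
     (\<exists>g. exterior_map Y \<delta> X \<epsilon> g \<and>
          (\<forall>x\<in>topspace X. g (f x) = x) \<and> (\<forall>y\<in>topspace Y. f (g y) = y))"

definition first_countable_at_infinity :: "'a set set \<Rightarrow> bool" where
  "first_countable_at_infinity \<epsilon> \<longleftrightarrow>
     (\<exists>E :: nat \<Rightarrow> 'a set. (\<forall>n. E n \<in> \<epsilon>) \<and> (\<forall>n. E (Suc n) \<subseteq> E n) \<and> (\<forall>F\<in>\<epsilon>. \<exists>n. E n \<subseteq> F))"


lemma exterior_space_openin: "exterior_space X \<epsilon> \<Longrightarrow> E \<in> \<epsilon> \<Longrightarrow> openin X E"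
  unfolding exterior_space_def by blast

lemma exterior_space_subset: "exterior_space X \<epsilon> \<Longrightarrow> E \<in> \<epsilon> \<Longrightarrow> E \<subseteq> topspace X"
  by (rule openin_subset[OF exterior_space_openin])

lemma exterior_space_Int: "exterior_space X \<epsilon> \<Longrightarrow> E \<in> \<epsilon> \<Longrightarrow> F \<in> \<epsilon> \<Longrightarrow> E \<inter> F \<in> \<epsilon>"
  unfolding exterior_space_def by blast

lemma exterior_space_upward:
  "exterior_space X \<epsilon> \<Longrightarrow> E \<in> \<epsilon> \<Longrightarrow> openin X U \<Longrightarrow> E \<subseteq> U \<Longrightarrow> U \<in> \<epsilon>"
  unfolding exterior_space_def by blast

lemma exterior_space_nonempty: "exterior_space X \<epsilon> \<Longrightarrow> \<exists>E. E \<in> \<epsilon>"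
  unfolding exterior_space_def by blast


section \<open>The functor of path components\<close>

abbreviation q0 :: "'a topology \<Rightarrow> 'a \<Rightarrow> 'a set" where
  "q0 Y \<equiv> path_component_of_set Y"

definition pi0 :: "'a topology \<Rightarrow> 'a set topology" where
  "pi0 Y = topology (\<lambda>G. G \<subseteq> path_components_of Y \<and> openin Y {y \<in> topspace Y. q0 Y y \<in> G})"

text \<open>The map induced on path components by a continuous map \<open>f\<close> into \<open>Y\<close>: all points of
  a path component are sent into one and the same path component of \<open>Y\<close>, so the union below
  is just that path component.\<close>

definition pi0_map :: "'b topology \<Rightarrow> ('a \<Rightarrow> 'b) \<Rightarrow> 'a set \<Rightarrow> 'b set" where
  "pi0_map Y f C = (\<Union>x\<in>C. q0 Y (f x))"

lemma openin_pi0: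
  "openin (pi0 Y) G \<longleftrightarrow> G \<subseteq> path_components_of Y \<and> openin Y {y \<in> topspace Y. q0 Y y \<in> G}"
proof -
  let ?P = "\<lambda>G. {y \<in> topspace Y. q0 Y y \<in> G}"
  have "istopology (\<lambda>G. G \<subseteq> path_components_of Y \<and> openin Y (?P G))"
    unfolding istopology_def
  proof (intro conjI allI impI)
    fix S T assume S: "S \<subseteq> path_components_of Y \<and> openin Y (?P S)"
      and T: "T \<subseteq> path_components_of Y \<and> openin Y (?P T)"
    then show "S \<inter> T \<subseteq> path_components_of Y" by blast
    have "?P (S \<inter> T) = ?P S \<inter> ?P T" by blast
    then show "openin Y (?P (S \<inter> T))" using S T by auto
  next
    fix \<K> assume K: "\<forall>S\<in>\<K>. S \<subseteq> path_components_of Y \<and> openin Y (?P S)"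
    then show "\<Union>\<K> \<subseteq> path_components_of Y" by blast
    have "?P (\<Union>\<K>) = \<Union>(?P ` \<K>)" by blast
    moreover have "openin Y (\<Union>(?P ` \<K>))" using K by (intro openin_Union) blast
    ultimately show "openin Y (?P (\<Union>\<K>))" by simp
  qed
  then show ?thesis by (simp add: pi0_def topology_inverse')
qed

lemma topspace_pi0: "topspace (pi0 Y) = path_components_of Y"
proof -
  have "{y \<in> topspace Y. q0 Y y \<in> path_components_of Y} = topspace Y"
    by (auto simp: path_components_of_def)
  then have "openin (pi0 Y) (path_components_of Y)" by (simp add: openin_pi0)
  then show ?thesis
    by (metis openin_pi0 openin_subset openin_topspace subset_antisym)
qed

lemma quotient_map_q0: "quotient_map Y (pi0 Y) (q0 Y)"
  by (auto simp: quotient_map_def topspace_pi0 openin_pi0 path_components_of_def)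


lemma pi0_map_q0:
  assumes "E \<subseteq> F" "F \<subseteq> topspace X" "x \<in> E"
  shows "pi0_map (subtopology X F) id (q0 (subtopology X E) x) = q0 (subtopology X F) x"
proof (rule set_eqI, rule iffI)
  fix z assume "z \<in> pi0_map (subtopology X F) id (q0 (subtopology X E) x)"
  then obtain y where y: "path_component_of (subtopology X E) x y" "path_component_of (subtopology X F) y z"
    by (auto simp: pi0_map_def)
  have "path_component_of (subtopology X F) x y"
    by (rule path_component_of_mono[OF y(1) assms(1)])
  then show "z \<in> q0 (subtopology X F) x"
    using path_component_of_trans[OF _ y(2)] by simp
next
  fix z assume "z \<in> q0 (subtopology X F) x"
  moreover have "path_component_of (subtopology X E) x x"
    using assms by (simp add: path_component_of_refl subset_iff)
  ultimately show "z \<in> pi0_map (subtopology X F) id (q0 (subtopology X E) x)"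
    unfolding pi0_map_def by (intro UN_I[of x]) simp_all
qed


section \<open>Limit and end spaces\<close>

definition limit_set :: "'a set set \<Rightarrow> 'a set" where
  "limit_set \<epsilon> = \<Inter>\<epsilon>"

text \<open>The inverse limit over the externology, ordered by inclusion, as the subspace of
  compatible families in the product. A point \<open>a\<close> is an extensional function on the
  externology, and its projection to the path components of \<open>E\<close> is \<open>a E\<close>.\<close>

definition check_pi0 :: "'a topology \<Rightarrow> 'a set set \<Rightarrow> ('a set \<Rightarrow> 'a set) topology" where
  "check_pi0 X \<epsilon> =
     subtopology (product_topology (\<lambda>E. pi0 (subtopology X E)) \<epsilon>)
       {a. \<forall>E\<in>\<epsilon>. \<forall>F\<in>\<epsilon>. E \<subseteq> F \<longrightarrow> pi0_map (subtopology X F) id (a E) = a F}"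

definition e0 :: "'a topology \<Rightarrow> 'a set set \<Rightarrow> 'a \<Rightarrow> 'a set \<Rightarrow> 'a set" where
  "e0 X \<epsilon> x = (\<lambda>E\<in>\<epsilon>. q0 (subtopology X E) x)"

lemma e0_in_check_pi0:
  assumes "exterior_space X \<epsilon>" "x \<in> limit_set \<epsilon>"
  shows "e0 X \<epsilon> x \<in> topspace (check_pi0 X \<epsilon>)"
proof -
  note sub = exterior_space_subset[OF assms(1)]
  have xE: "x \<in> E" if "E \<in> \<epsilon>" for E
    using assms(2) that by (simp add: limit_set_def)
  have 1: "q0 (subtopology X E) x \<in> path_components_of (subtopology X E)" if "E \<in> \<epsilon>" for E
    unfolding path_components_of_def using sub[OF that] xE[OF that] by (intro imageI) auto
  have 2: "pi0_map (subtopology X F) id (q0 (subtopology X E) x) = q0 (subtopology X F) x"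
    if "E \<in> \<epsilon>" "F \<in> \<epsilon>" "E \<subseteq> F" for E F
    by (rule pi0_map_q0[OF that(3) sub[OF that(2)] xE[OF that(1)]])
  show ?thesis
    unfolding check_pi0_def e0_def topspace_subtopology topspace_product_topology topspace_pi0 o_def
    by (intro IntI CollectI ballI impI restrict_PiE_iff[THEN iffD2]) (simp_all add: 1 2 del: topspace_subtopology)
qed


section \<open>The completion\<close>

text \<open>The push-out of the inclusion of the limit set and \<open>e0\<close> is the disjoint union modulo
  the equivalence relation generated by identifying \<open>Inl x\<close> with \<open>Inr (e0 X \<epsilon> x)\<close>;
  its elements are equivalence classes.\<close>

definition glue :: "'a topology \<Rightarrow> 'a set set \<Rightarrow>
    'a + ('a set \<Rightarrow> 'a set) \<Rightarrow> 'a + ('a set \<Rightarrow> 'a set) \<Rightarrow> bool" where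
  "glue X \<epsilon> u v \<longleftrightarrow> (\<exists>x\<in>limit_set \<epsilon>. u = Inl x \<and> v = Inr (e0 X \<epsilon> x))"

definition glue_rel :: "'a topology \<Rightarrow> 'a set set \<Rightarrow>
    (('a + ('a set \<Rightarrow> 'a set)) \<times> ('a + ('a set \<Rightarrow> 'a set))) set" where
  "glue_rel X \<epsilon> =
     {(u, v). u \<in> topspace X <+> topspace (check_pi0 X \<epsilon>) \<and>
              v \<in> topspace X <+> topspace (check_pi0 X \<epsilon>) \<and> equivclp (glue X \<epsilon>) u v}"

definition C0_points :: "'a topology \<Rightarrow> 'a set set \<Rightarrow> ('a + ('a set \<Rightarrow> 'a set)) set set" where
  "C0_points X \<epsilon> = (topspace X <+> topspace (check_pi0 X \<epsilon>)) // glue_rel X \<epsilon>"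

definition p0 :: "'a topology \<Rightarrow> 'a set set \<Rightarrow> 'a \<Rightarrow> ('a + ('a set \<Rightarrow> 'a set)) set" where
  "p0 X \<epsilon> x = glue_rel X \<epsilon> `` {Inl x}"

definition in0 :: "'a topology \<Rightarrow> 'a set set \<Rightarrow> ('a set \<Rightarrow> 'a set) \<Rightarrow> ('a + ('a set \<Rightarrow> 'a set)) set" where
  "in0 X \<epsilon> a = glue_rel X \<epsilon> `` {Inr a}"

definition C0_open :: "'a topology \<Rightarrow> 'a set set \<Rightarrow> ('a + ('a set \<Rightarrow> 'a set)) set set \<Rightarrow> bool" where
  "C0_open X \<epsilon> W \<longleftrightarrow>
     W \<subseteq> C0_points X \<epsilon> \<and>
     openin X {x \<in> topspace X. p0 X \<epsilon> x \<in> W} \<and>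
     openin (check_pi0 X \<epsilon>) {a \<in> topspace (check_pi0 X \<epsilon>). in0 X \<epsilon> a \<in> W} \<and>
     (\<forall>a\<in>topspace (check_pi0 X \<epsilon>). in0 X \<epsilon> a \<in> W \<longrightarrow>
        (\<exists>E\<in>\<epsilon>. \<exists>G. openin (pi0 (subtopology X E)) G \<and>
           a E \<in> G \<and>
           (\<forall>b\<in>topspace (check_pi0 X \<epsilon>). b E \<in> G \<longrightarrow> in0 X \<epsilon> b \<in> W) \<and>
           (\<forall>x\<in>E. q0 (subtopology X E) x \<in> G \<longrightarrow> p0 X \<epsilon> x \<in> W)))"

definition C0_topology :: "'a topology \<Rightarrow> 'a set set \<Rightarrow> ('a + ('a set \<Rightarrow> 'a set)) set topology" where
  "C0_topology X \<epsilon> = topology (C0_open X \<epsilon>)"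

definition W0 :: "'a topology \<Rightarrow> 'a set set \<Rightarrow> 'a set \<Rightarrow> ('a + ('a set \<Rightarrow> 'a set)) set set" where
  "W0 X \<epsilon> E = p0 X \<epsilon> ` E \<union> in0 X \<epsilon> ` topspace (check_pi0 X \<epsilon>)"

definition C0_externology :: "'a topology \<Rightarrow> 'a set set \<Rightarrow> ('a + ('a set \<Rightarrow> 'a set)) set set set" where
  "C0_externology X \<epsilon> = W0 X \<epsilon> ` \<epsilon>"

definition C0_complete :: "'a topology \<Rightarrow> 'a set set \<Rightarrow> bool" where
  "C0_complete X \<epsilon> \<longleftrightarrow>
     exterior_space X \<epsilon> \<and>
     exterior_isomorphism X \<epsilon> (C0_topology X \<epsilon>) (C0_externology X \<epsilon>) (p0 X \<epsilon>)"


section \<open>The completion is an exterior space\<close>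

lemma equiv_glue_rel:
  "equiv (topspace X <+> topspace (check_pi0 X \<epsilon>)) (glue_rel X \<epsilon>)"
proof (rule equivI)
  show "glue_rel X \<epsilon> \<subseteq> (topspace X <+> topspace (check_pi0 X \<epsilon>)) \<times> (topspace X <+> topspace (check_pi0 X \<epsilon>))"
    unfolding glue_rel_def by blast
  show "refl_on (topspace X <+> topspace (check_pi0 X \<epsilon>)) (glue_rel X \<epsilon>)"
    by (rule refl_onI) (simp add: glue_rel_def)
  show "sym (glue_rel X \<epsilon>)"
    by (rule symI) (auto simp: glue_rel_def intro: equivclp_sym)
  show "trans (glue_rel X \<epsilon>)"
    by (rule transI) (auto simp: glue_rel_def intro: equivclp_trans)
qed

lemma p0_in_C0_points: "x \<in> topspace X \<Longrightarrow> p0 X \<epsilon> x \<in> C0_points X \<epsilon>"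
  unfolding p0_def C0_points_def by (intro quotientI) blast

lemma in0_in_C0_points: "a \<in> topspace (check_pi0 X \<epsilon>) \<Longrightarrow> in0 X \<epsilon> a \<in> C0_points X \<epsilon>"
  unfolding in0_def C0_points_def by (intro quotientI) blast

lemma C0_points_cases:
  assumes "w \<in> C0_points X \<epsilon>"
  obtains x where "x \<in> topspace X" "w = p0 X \<epsilon> x"
        | a where "a \<in> topspace (check_pi0 X \<epsilon>)" "w = in0 X \<epsilon> a"
  using assms unfolding p0_def in0_def C0_points_def by (auto elim!: quotientE)

lemma p0_eq_in0:
  assumes "exterior_space X \<epsilon>" "x \<in> limit_set \<epsilon>"
  shows "p0 X \<epsilon> x = in0 X \<epsilon> (e0 X \<epsilon> x)"
proof -
  obtain E where E: "E \<in> \<epsilon>" using exterior_space_nonempty[OF assms(1)] by blast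
  then have "x \<in> topspace X"
    using assms(2) exterior_space_subset[OF assms(1) E] by (auto simp: limit_set_def)
  moreover have "equivclp (glue X \<epsilon>) (Inl x) (Inr (e0 X \<epsilon> x))"
    using assms(2) by (intro r_into_equivclp) (auto simp: glue_def)
  ultimately have "(Inl x, Inr (e0 X \<epsilon> x)) \<in> glue_rel X \<epsilon>"
    using e0_in_check_pi0[OF assms] by (simp add: glue_rel_def Plus_def)
  then show ?thesis
    unfolding p0_def in0_def by (rule equiv_class_eq[OF equiv_glue_rel])
qed

lemma glue_no_new_identifications:
  assumes "equivclp (glue X \<epsilon>) u v"
  shows "u = v \<or> (case_sum (\<lambda>x. x \<in> limit_set \<epsilon>) (\<lambda>_. True) u \<and>
                  case_sum (\<lambda>x. x \<in> limit_set \<epsilon>) (\<lambda>_. True) v \<and>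
                  case_sum (e0 X \<epsilon>) id u = case_sum (e0 X \<epsilon>) id v)"
  using assms
proof (induction rule: equivclp_induct)
  case base
  then show ?case by simp
next
  case (step y z)
  then show ?case by (auto simp: glue_def)
qed

lemma p0_eq_imp:
  assumes "x \<in> topspace X" "y \<in> topspace X" "p0 X \<epsilon> x = p0 X \<epsilon> y"
  shows "x = y \<or> (x \<in> limit_set \<epsilon> \<and> y \<in> limit_set \<epsilon> \<and> e0 X \<epsilon> x = e0 X \<epsilon> y)"
proof -
  have "(Inl x, Inl y) \<in> glue_rel X \<epsilon>"
    using assms eq_equiv_class[OF _ equiv_glue_rel, of X \<epsilon> "Inl x" "Inl y"]
    unfolding p0_def by (auto simp: Plus_def)
  then have "equivclp (glue X \<epsilon>) (Inl x) (Inl y)" by (simp add: glue_rel_def)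
  from glue_no_new_identifications[OF this] show ?thesis by auto
qed

lemma p0_eq_in0_imp:
  assumes "x \<in> topspace X" "a \<in> topspace (check_pi0 X \<epsilon>)" "p0 X \<epsilon> x = in0 X \<epsilon> a"
  shows "x \<in> limit_set \<epsilon> \<and> e0 X \<epsilon> x = a"
proof -
  have "(Inl x, Inr a) \<in> glue_rel X \<epsilon>"
    using assms eq_equiv_class[OF _ equiv_glue_rel, of X \<epsilon> "Inl x" "Inr a"]
    unfolding p0_def in0_def by (auto simp: Plus_def)
  then have "equivclp (glue X \<epsilon>) (Inl x) (Inr a)" by (simp add: glue_rel_def)
  from glue_no_new_identifications[OF this] show ?thesis by auto
qed

lemma check_pi0_mem:
  assumes "a \<in> topspace (check_pi0 X \<epsilon>)" "E \<in> \<epsilon>"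
  shows "a E \<in> path_components_of (subtopology X E)"
  using assms by (auto simp: check_pi0_def topspace_pi0)

lemma check_pi0_mono:
  assumes "a \<in> topspace (check_pi0 X \<epsilon>)" "E \<in> \<epsilon>" "F \<in> \<epsilon>" "E \<subseteq> F"
  shows "pi0_map (subtopology X F) id (a E) = a F"
  using assms by (auto simp: check_pi0_def)

lemma openin_pi0_pullback:
  assumes "exterior_space X \<epsilon>" "E \<in> \<epsilon>" "F \<in> \<epsilon>" "E \<subseteq> F" "openin (pi0 (subtopology X F)) G"
  shows "openin (pi0 (subtopology X E))
           {C \<in> path_components_of (subtopology X E). pi0_map (subtopology X F) id C \<in> G}"
proof -
  note E = exterior_space_openin[OF assms(1,2)] and F = exterior_space_openin[OF assms(1,3)]
  have tE: "topspace (subtopology X E) = E" and tF: "topspace (subtopology X F) = F"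
    using openin_subset[OF E] openin_subset[OF F] by auto
  have "openin X {x \<in> F. q0 (subtopology X F) x \<in> G}"
    using assms(5) unfolding openin_pi0 tF openin_open_subtopology[OF F] by blast
  then have "openin X (E \<inter> {x \<in> F. q0 (subtopology X F) x \<in> G})" using E by blast
  moreover have "{y \<in> E. q0 (subtopology X E) y \<in> {C \<in> path_components_of (subtopology X E).
        pi0_map (subtopology X F) id C \<in> G}} = E \<inter> {x \<in> F. q0 (subtopology X F) x \<in> G}" (is "?A = ?B")
  proof (rule set_eqI)
    fix x
    have "q0 (subtopology X E) x \<in> path_components_of (subtopology X E)" if "x \<in> E"
      unfolding path_components_of_def tE using that by (rule imageI)
    then show "x \<in> ?A \<longleftrightarrow> x \<in> ?B"
      using pi0_map_q0[OF \<open>E \<subseteq> F\<close> openin_subset[OF F], of x] \<open>E \<subseteq> F\<close> by auto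
  qed
  ultimately show ?thesis
    unfolding openin_pi0 tE openin_open_subtopology[OF E] by auto
qed

lemma C0_open_nbhd:
  assumes "C0_open X \<epsilon> W" "a \<in> topspace (check_pi0 X \<epsilon>)" "in0 X \<epsilon> a \<in> W"
  obtains E G where "E \<in> \<epsilon>" "openin (pi0 (subtopology X E)) G" "a E \<in> G"
    "\<And>b. b \<in> topspace (check_pi0 X \<epsilon>) \<Longrightarrow> b E \<in> G \<Longrightarrow> in0 X \<epsilon> b \<in> W"
    "\<And>x. x \<in> E \<Longrightarrow> q0 (subtopology X E) x \<in> G \<Longrightarrow> p0 X \<epsilon> x \<in> W"
proof -
  have "\<exists>E\<in>\<epsilon>. \<exists>G. openin (pi0 (subtopology X E)) G \<and> a E \<in> G \<and>
           (\<forall>b\<in>topspace (check_pi0 X \<epsilon>). b E \<in> G \<longrightarrow> in0 X \<epsilon> b \<in> W) \<and>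
           (\<forall>x\<in>E. q0 (subtopology X E) x \<in> G \<longrightarrow> p0 X \<epsilon> x \<in> W)"
    using assms by (simp add: C0_open_def)
  then show thesis
    by (elim bexE exE conjE) (rule that, (assumption | blast)+)
qed

lemma istopology_C0_open:
  assumes X: "exterior_space X \<epsilon>"
  shows "istopology (C0_open X \<epsilon>)"
  unfolding istopology_def
proof (intro conjI allI impI)
  let ?T = "topspace (check_pi0 X \<epsilon>)"
  fix S T assume S: "C0_open X \<epsilon> S" and T: "C0_open X \<epsilon> T"
  have e1: "{x \<in> topspace X. p0 X \<epsilon> x \<in> S \<inter> T}
     = {x \<in> topspace X. p0 X \<epsilon> x \<in> S} \<inter> {x \<in> topspace X. p0 X \<epsilon> x \<in> T}" by blast
  have e2: "{x \<in> ?T. in0 X \<epsilon> x \<in> S \<inter> T}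
     = {x \<in> ?T. in0 X \<epsilon> x \<in> S} \<inter> {x \<in> ?T. in0 X \<epsilon> x \<in> T}" by blast
  show "C0_open X \<epsilon> (S \<inter> T)"
    unfolding C0_open_def e1 e2
  proof (intro conjI ballI impI)
    show "S \<inter> T \<subseteq> C0_points X \<epsilon>" using S by (auto simp: C0_open_def)
    show "openin X ({x \<in> topspace X. p0 X \<epsilon> x \<in> S} \<inter> {x \<in> topspace X. p0 X \<epsilon> x \<in> T})"
      using S T by (intro openin_Int) (auto simp: C0_open_def)
    show "openin (check_pi0 X \<epsilon>) ({x \<in> ?T. in0 X \<epsilon> x \<in> S} \<inter> {x \<in> ?T. in0 X \<epsilon> x \<in> T})"
      using S T by (intro openin_Int) (auto simp: C0_open_def)
    fix a assume a: "a \<in> ?T" "in0 X \<epsilon> a \<in> S \<inter> T"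
    obtain E G where E: "E \<in> \<epsilon>" "openin (pi0 (subtopology X E)) G" "a E \<in> G"
        "\<And>b. b \<in> ?T \<Longrightarrow> b E \<in> G \<Longrightarrow> in0 X \<epsilon> b \<in> S"
        "\<And>x. x \<in> E \<Longrightarrow> q0 (subtopology X E) x \<in> G \<Longrightarrow> p0 X \<epsilon> x \<in> S"
      by (rule C0_open_nbhd[OF S a(1) IntD1[OF a(2)]]) blast
    obtain F H where F: "F \<in> \<epsilon>" "openin (pi0 (subtopology X F)) H" "a F \<in> H"
        "\<And>b. b \<in> ?T \<Longrightarrow> b F \<in> H \<Longrightarrow> in0 X \<epsilon> b \<in> T"
        "\<And>x. x \<in> F \<Longrightarrow> q0 (subtopology X F) x \<in> H \<Longrightarrow> p0 X \<epsilon> x \<in> T"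
      by (rule C0_open_nbhd[OF T a(1) IntD2[OF a(2)]]) blast
    define D where "D = E \<inter> F"
    have D: "D \<in> \<epsilon>" "D \<subseteq> E" "D \<subseteq> F" using exterior_space_Int[OF X E(1) F(1)] by (auto simp: D_def)
    note sub = exterior_space_subset[OF X E(1)] exterior_space_subset[OF X F(1)]
    define K where "K = {C \<in> path_components_of (subtopology X D). pi0_map (subtopology X E) id C \<in> G}
        \<inter> {C \<in> path_components_of (subtopology X D). pi0_map (subtopology X F) id C \<in> H}"
    have "openin (pi0 (subtopology X D)) K"
      unfolding K_def
      by (intro openin_Int openin_pi0_pullback[OF X D(1) E(1) D(2) E(2)]
          openin_pi0_pullback[OF X D(1) F(1) D(3) F(2)])
    moreover have K: "b D \<in> K \<longleftrightarrow> b E \<in> G \<and> b F \<in> H" if "b \<in> ?T" for b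
      using check_pi0_mem[OF that D(1)] check_pi0_mono[OF that D(1) E(1) D(2)]
        check_pi0_mono[OF that D(1) F(1) D(3)] by (auto simp: K_def)
    moreover have "p0 X \<epsilon> x \<in> S \<inter> T" if "x \<in> D" "q0 (subtopology X D) x \<in> K" for x
      using that E(5) F(5) D pi0_map_q0[OF D(2) sub(1) that(1)] pi0_map_q0[OF D(3) sub(2) that(1)]
      by (auto simp: K_def)
    ultimately show "\<exists>E\<in>\<epsilon>. \<exists>G. openin (pi0 (subtopology X E)) G \<and> a E \<in> G \<and>
           (\<forall>b\<in>?T. b E \<in> G \<longrightarrow> in0 X \<epsilon> b \<in> S \<inter> T) \<and>
           (\<forall>x\<in>E. q0 (subtopology X E) x \<in> G \<longrightarrow> p0 X \<epsilon> x \<in> S \<inter> T)"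
      using D(1) a(1) E(3,4) F(3,4) by (intro bexI[of _ D] exI[of _ K]) auto
  qed
next
  let ?T = "topspace (check_pi0 X \<epsilon>)"
  fix \<K> assume K: "\<forall>S\<in>\<K>. C0_open X \<epsilon> S"
  have e1: "{x \<in> topspace X. p0 X \<epsilon> x \<in> \<Union>\<K>} = \<Union>((\<lambda>S. {x \<in> topspace X. p0 X \<epsilon> x \<in> S}) ` \<K>)"
    by blast
  have e2: "{x \<in> ?T. in0 X \<epsilon> x \<in> \<Union>\<K>} = \<Union>((\<lambda>S. {x \<in> ?T. in0 X \<epsilon> x \<in> S}) ` \<K>)" by blast
  show "C0_open X \<epsilon> (\<Union>\<K>)"
    unfolding C0_open_def e1 e2
  proof (intro conjI ballI impI)
    show "\<Union>\<K> \<subseteq> C0_points X \<epsilon>" using K by (auto simp: C0_open_def)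
    show "openin X (\<Union>((\<lambda>S. {x \<in> topspace X. p0 X \<epsilon> x \<in> S}) ` \<K>))"
      using K by (intro openin_Union) (auto simp: C0_open_def)
    show "openin (check_pi0 X \<epsilon>) (\<Union>((\<lambda>S. {x \<in> ?T. in0 X \<epsilon> x \<in> S}) ` \<K>))"
      using K by (intro openin_Union) (auto simp: C0_open_def)
    fix a assume a: "a \<in> ?T" "in0 X \<epsilon> a \<in> \<Union>\<K>"
    then obtain S where S: "S \<in> \<K>" "in0 X \<epsilon> a \<in> S" by blast
    then have oS: "C0_open X \<epsilon> S" using K by blast
    obtain E G where E: "E \<in> \<epsilon>" "openin (pi0 (subtopology X E)) G" "a E \<in> G"
        "\<And>b. b \<in> ?T \<Longrightarrow> b E \<in> G \<Longrightarrow> in0 X \<epsilon> b \<in> S"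
        "\<And>x. x \<in> E \<Longrightarrow> q0 (subtopology X E) x \<in> G \<Longrightarrow> p0 X \<epsilon> x \<in> S"
      by (rule C0_open_nbhd[OF oS a(1) S(2)]) blast
    then show "\<exists>E\<in>\<epsilon>. \<exists>G. openin (pi0 (subtopology X E)) G \<and> a E \<in> G \<and>
           (\<forall>b\<in>?T. b E \<in> G \<longrightarrow> in0 X \<epsilon> b \<in> \<Union>\<K>) \<and>
           (\<forall>x\<in>E. q0 (subtopology X E) x \<in> G \<longrightarrow> p0 X \<epsilon> x \<in> \<Union>\<K>)"
      using S(1) by (intro bexI[of _ E] exI[of _ G]) auto
  qed
qed

lemma openin_C0_topology:
  "exterior_space X \<epsilon> \<Longrightarrow> openin (C0_topology X \<epsilon>) W \<longleftrightarrow> C0_open X \<epsilon> W"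
  by (simp add: C0_topology_def topology_inverse' istopology_C0_open)

lemma p0_vimage_W0:
  assumes "exterior_space X \<epsilon>" "E \<in> \<epsilon>"
  shows "{x \<in> topspace X. p0 X \<epsilon> x \<in> W0 X \<epsilon> E} = E"
proof -
  note exterior_space_subset[OF assms]
  moreover have "limit_set \<epsilon> \<subseteq> E" using assms by (auto simp: limit_set_def)
  ultimately show ?thesis
    using p0_eq_imp[of _ X _ \<epsilon>] p0_eq_in0_imp[of _ X _ \<epsilon>] unfolding W0_def by blast
qed

lemma C0_open_W0:
  assumes "exterior_space X \<epsilon>" "E \<in> \<epsilon>"
  shows "C0_open X \<epsilon> (W0 X \<epsilon> E)"
  unfolding C0_open_def p0_vimage_W0[OF assms]
proof (intro conjI ballI impI)
  let ?T = "topspace (check_pi0 X \<epsilon>)"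
  show E: "openin X E" by (rule exterior_space_openin[OF assms])
  show "W0 X \<epsilon> E \<subseteq> C0_points X \<epsilon>"
    unfolding W0_def using openin_subset[OF E]
    by (intro Un_least image_subsetI p0_in_C0_points in0_in_C0_points) auto
  have "{a \<in> ?T. in0 X \<epsilon> a \<in> W0 X \<epsilon> E} = ?T" by (auto simp: W0_def)
  then show "openin (check_pi0 X \<epsilon>) {a \<in> ?T. in0 X \<epsilon> a \<in> W0 X \<epsilon> E}" by simp
  fix a assume a: "a \<in> ?T"
  show "\<exists>F\<in>\<epsilon>. \<exists>G. openin (pi0 (subtopology X F)) G \<and> a F \<in> G \<and>
           (\<forall>b\<in>?T. b F \<in> G \<longrightarrow> in0 X \<epsilon> b \<in> W0 X \<epsilon> E) \<and>
           (\<forall>x\<in>F. q0 (subtopology X F) x \<in> G \<longrightarrow> p0 X \<epsilon> x \<in> W0 X \<epsilon> E)"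
  proof (intro bexI[of _ E] exI[of _ "path_components_of (subtopology X E)"] conjI ballI impI)
    show "openin (pi0 (subtopology X E)) (path_components_of (subtopology X E))"
      using openin_topspace[of "pi0 (subtopology X E)"] by (simp only: topspace_pi0)
    show "a E \<in> path_components_of (subtopology X E)" by (rule check_pi0_mem[OF a assms(2)])
  qed (simp_all add: W0_def assms(2))
qed

lemma exterior_space_C0:
  assumes X: "exterior_space X \<epsilon>"
  shows "exterior_space (C0_topology X \<epsilon>) (C0_externology X \<epsilon>)"
  unfolding exterior_space_def
proof (intro conjI ballI allI impI)
  show "C0_externology X \<epsilon> \<noteq> {}"
    using exterior_space_nonempty[OF X] by (auto simp: C0_externology_def)
  fix V assume "V \<in> C0_externology X \<epsilon>"
  then obtain E where E: "E \<in> \<epsilon>" "V = W0 X \<epsilon> E" by (auto simp: C0_externology_def)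
  then show "openin (C0_topology X \<epsilon>) V"
    using C0_open_W0[OF X] by (simp add: openin_C0_topology[OF X])
  note sub = exterior_space_subset[OF X]
  { fix V' assume "V' \<in> C0_externology X \<epsilon>"
    then obtain F where F: "F \<in> \<epsilon>" "V' = W0 X \<epsilon> F" by (auto simp: C0_externology_def)
    have "E \<inter> F \<in> \<epsilon>" using exterior_space_Int[OF X E(1) F(1)] .
    moreover have "V \<inter> V' = W0 X \<epsilon> (E \<inter> F)"
    proof
      show "W0 X \<epsilon> (E \<inter> F) \<subseteq> V \<inter> V'" unfolding E F W0_def by blast
      show "V \<inter> V' \<subseteq> W0 X \<epsilon> (E \<inter> F)"
      proof
        fix w assume w: "w \<in> V \<inter> V'"
        show "w \<in> W0 X \<epsilon> (E \<inter> F)"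
        proof (cases "w \<in> in0 X \<epsilon> ` topspace (check_pi0 X \<epsilon>)")
          case True
          then show ?thesis by (simp add: W0_def)
        next
          case False
          then obtain x where x: "x \<in> E" "w = p0 X \<epsilon> x" using w E by (auto simp: W0_def)
          then have "x \<in> {x \<in> topspace X. p0 X \<epsilon> x \<in> W0 X \<epsilon> F}" using w F sub[OF E(1)] by auto
          then have "x \<in> F" using p0_vimage_W0[OF X F(1)] by simp
          then show ?thesis using x by (auto simp: W0_def)
        qed
      qed
    qed
    ultimately show "V \<inter> V' \<in> C0_externology X \<epsilon>" by (auto simp: C0_externology_def)
  }
  fix U assume U: "openin (C0_topology X \<epsilon>) U \<and> V \<subseteq> U"
  then have CU: "C0_open X \<epsilon> U" by (simp add: openin_C0_topology[OF X])
  define F where "F = {x \<in> topspace X. p0 X \<epsilon> x \<in> U}"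
  have "openin X F" using CU by (simp add: C0_open_def F_def)
  moreover have "E \<subseteq> F" using sub[OF E(1)] U E by (auto simp: F_def W0_def)
  ultimately have "F \<in> \<epsilon>" using exterior_space_upward[OF X E(1)] by blast
  moreover have "U = W0 X \<epsilon> F"
  proof
    show "W0 X \<epsilon> F \<subseteq> U" using U E by (auto simp: F_def W0_def)
    show "U \<subseteq> W0 X \<epsilon> F"
    proof
      fix w assume "w \<in> U"
      moreover from this have "w \<in> C0_points X \<epsilon>" using CU by (auto simp: C0_open_def)
      ultimately show "w \<in> W0 X \<epsilon> F"
        by (elim C0_points_cases) (auto simp: F_def W0_def)
    qed
  qed
  ultimately show "U \<in> C0_externology X \<epsilon>" by (auto simp: C0_externology_def)
qed

lemma topspace_C0_topology:
  assumes X: "exterior_space X \<epsilon>"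
  shows "topspace (C0_topology X \<epsilon>) = C0_points X \<epsilon>"
proof -
  have T: "topspace X \<in> \<epsilon>"
    using exterior_space_nonempty[OF X] exterior_space_upward[OF X] exterior_space_subset[OF X] by blast
  have "C0_points X \<epsilon> \<subseteq> W0 X \<epsilon> (topspace X)"
    by (auto simp: W0_def elim!: C0_points_cases)
  then have "C0_open X \<epsilon> (C0_points X \<epsilon>)"
    using C0_open_W0[OF X T] by (metis C0_open_def subset_antisym)
  then show ?thesis
    by (metis X C0_open_def openin_C0_topology openin_subset openin_topspace subset_antisym)
qed

lemma exterior_map_p0:
  assumes X: "exterior_space X \<epsilon>"
  shows "exterior_map X \<epsilon> (C0_topology X \<epsilon>) (C0_externology X \<epsilon>) (p0 X \<epsilon>)"
  unfolding exterior_map_def continuous_map_def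
  using p0_vimage_W0[OF X]
  by (auto simp: topspace_C0_topology[OF X] openin_C0_topology[OF X] C0_externology_def
      C0_open_def p0_in_C0_points)

end

theory Submission
  imports Defs
begin

text \<open>Write \<open>Y\<close> for the completion of \<open>X\<close>. Its limit set is the copy \<open>in0\<close> of the end space of
\<open>X\<close> (\<open>limit_set_C0\<close>). Completing \<open>Y\<close> once more glues the end space of \<open>Y\<close> along this limit set,
so it changes nothing as a set if \<open>e0\<close> maps the limit set of \<open>Y\<close> bijectively onto the end space of
\<open>Y\<close>, that is, if \<open>X\<close> and \<open>Y\<close> have the same ends.

To compare the ends, consider for a path component \<open>C\<close> of an exterior open set \<open>E\<close> the completed
component: \<open>C\<close> together with all the end points that pass through \<open>C\<close>. These sets partition
\<open>W0 X \<epsilon> E\<close>. They are open (\<open>openin_completed_component\<close>), since in a locally path-connected space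
the path components of open sets are open. They are path-connected
(\<open>path_connectedin_completed_component\<close>): along a countable base of the externology, an end
selects a decreasing sequence of path-connected sets that shrinks to the end point in \<open>Y\<close>, and
paths inside these sets concatenate to a path that arrives at the end point
(\<open>path_component_of_limit\<close>). Hence the completed components are exactly the path components of
\<open>W0 X \<epsilon> E\<close> (\<open>path_components_of_W0\<close>), and the ends of \<open>X\<close> and \<open>Y\<close> correspond
(\<open>bij_betw_e0_C0\<close>).

For the topology, a neighbourhood of an end point in \<open>Y\<close> contains a completed component around that
point, which is an open path component of some \<open>W0 X \<epsilon> E\<close>. This is the neighbourhood condition in
the topology of the second completion, so \<open>p0\<close> is an open map as well (\<open>C0_completeI\<close>).\<close>

section \<open>Paths and path components\<close>

lemma path_component_of_set_eq_clopen:
  assumes "openin Z K" "closedin Z K" "path_connectedin Z K" "w \<in> K"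
  shows "path_component_of_set Z w = K"
proof
  have "connectedin Z (path_component_of_set Z w)"
    by (intro path_connectedin_imp_connectedin path_connectedin_path_component_of)
  then have "path_component_of_set Z w \<subseteq> K \<or> disjnt (path_component_of_set Z w) K"
    using assms(1,2) by (simp add: connectedin_clopen_cases)
  moreover have "w \<in> path_component_of_set Z w"
    using assms(3,4) path_connectedin_subset_topspace by (fastforce simp: path_component_of_refl)
  ultimately show "path_component_of_set Z w \<subseteq> K"
    using assms(4) by (auto simp: disjnt_iff)
  show "K \<subseteq> path_component_of_set Z w"
    using assms(3,4) by (simp add: path_component_of_maximal)
qed

text \<open>A decreasing sequence of path-connected sets that shrinks to \<open>y\<close> gives an infinite
chain of paths, the \<open>n\<close>-th one inside \<open>U n\<close>. Run through in finite time, the chain is a path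
on the half-open interval, and it extends continuously by the value \<open>y\<close>, because every
neighbourhood of \<open>y\<close> contains all but finitely many of the paths.\<close>

lemma path_component_of_limit:
  fixes U :: "nat \<Rightarrow> 'a set"
  assumes conn: "\<And>n. path_connectedin Y (U n)"
    and ne: "\<And>n. U n \<noteq> {}"
    and dec: "decseq U"
    and y: "y \<in> topspace Y"
    and lim: "\<And>V. openin Y V \<Longrightarrow> y \<in> V \<Longrightarrow> \<exists>n. U n \<subseteq> V"
    and x: "x \<in> U 0"
  shows "path_component_of (subtopology Y (insert y (U 0))) x y"
proof -
  define z where "z n = (if n = 0 then x else SOME w. w \<in> U n)" for n
  have z0: "z 0 = x" by (simp add: z_def)
  have z: "z n \<in> U n" for n
    using x ne[of n] by (simp add: z_def some_in_eq)
  have "\<exists>g. pathin Y g \<and> g ` {0..1} \<subseteq> U n \<and> g 0 = z n \<and> g 1 = z (Suc n)" for n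
  proof -
    have "z (Suc n) \<in> U n" using z[of "Suc n"] decseq_SucD[OF dec, of n] by (rule subsetD[rotated])
    then show ?thesis
      using conn[of n] z[of n] unfolding path_connectedin image_subset_iff_funcset by meson
  qed
  then obtain \<gamma> where \<gamma>: "\<And>n. pathin Y (\<gamma> n)" "\<And>n. \<gamma> n ` {0..1} \<subseteq> U n"
      "\<And>n. \<gamma> n 0 = z n" "\<And>n. \<gamma> n 1 = z (Suc n)"
    by metis
  \<comment> \<open>The infinite concatenation, parametrized by the half-line: the \<open>n\<close>-th path occupies \<open>[n, n + 1]\<close>.\<close>
  define h where "h s = \<gamma> (nat \<lfloor>s\<rfloor>) (s - real (nat \<lfloor>s\<rfloor>))" for s :: real
  have h_in: "h s \<in> U n" if "s \<ge> real n" for s n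
  proof -
    have "n \<le> nat \<lfloor>s\<rfloor>" using that by linarith
    moreover have "s - real (nat \<lfloor>s\<rfloor>) \<in> {0..1}" using that by (simp; linarith)
    ultimately show ?thesis
      using \<gamma>(2)[of "nat \<lfloor>s\<rfloor>"] decseqD[OF dec] unfolding h_def by blast
  qed
  have h_cont: "continuous_map (top_of_set {0..}) Y h"
  proof (rule pasting_lemma_locally_finite[where I = UNIV and T = "\<lambda>n. {real n..real n + 1}"
        and f = "\<lambda>n s. \<gamma> n (s - real n)"])
    fix s :: real assume "s \<in> topspace (top_of_set {0..})"
    then have "0 \<le> s" by simp
    have "{n. {real n..real n + 1} \<inter> {0..<s + 1} \<noteq> {}} \<subseteq> {..nat \<lceil>s + 1\<rceil>}"
      by (auto; linarith)
    then have "finite {n. {real n..real n + 1} \<inter> {0..<s + 1} \<noteq> {}}"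
      by (rule finite_subset) simp
    moreover have "openin (top_of_set {0..}) {0..<s + 1}"
      unfolding openin_open by (intro exI[of _ "{..<s + 1}"]) auto
    ultimately show "\<exists>V. openin (top_of_set {0..}) V \<and> s \<in> V \<and>
        finite {n \<in> UNIV. {real n..real n + 1} \<inter> V \<noteq> {}}"
      using \<open>0 \<le> s\<close> by (intro exI[of _ "{0..<s + 1}"]) auto
  next
    fix n
    show "closedin (top_of_set {0..}) {real n..real n + 1}"
      by (rule closed_subset) auto
    have eq: "subtopology (top_of_set {0..}) {real n..real n + 1} = top_of_set {real n..real n + 1}"
      by (simp add: subtopology_subtopology Int_absorb1)
    have "continuous_map (top_of_set {real n..real n + 1}) (top_of_set {0..1}) (\<lambda>s. s - real n)"
      by (auto intro!: continuous_intros)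
    then have "continuous_map (top_of_set {real n..real n + 1}) Y (\<gamma> n \<circ> (\<lambda>s. s - real n))"
      using \<gamma>(1)[of n] unfolding pathin_def by (rule continuous_map_compose)
    then show "continuous_map (subtopology (top_of_set {0..}) {real n..real n + 1}) Y
        (\<lambda>s. \<gamma> n (s - real n))"
      unfolding eq by (simp only: o_def)
  next
    fix m n :: nat and s :: real
    assume "s \<in> topspace (top_of_set {0..}) \<inter> {real m..real m + 1} \<inter> {real n..real n + 1}"
    then have s: "real m \<le> s" "s \<le> real m + 1" "real n \<le> s" "s \<le> real n + 1" by auto
    then have "m = n \<or> n = Suc m \<or> m = Suc n" by linarith
    then show "\<gamma> m (s - real m) = \<gamma> n (s - real n)"
    proof (elim disjE)
      assume "n = Suc m"
      moreover from this s have "s = real m + 1" by simp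
      ultimately show ?thesis using \<gamma>(3,4) by simp
    next
      assume "m = Suc n"
      moreover from this s have "s = real n + 1" by simp
      ultimately show ?thesis using \<gamma>(3,4) by simp
    qed simp
  next
    fix s :: real assume "s \<in> topspace (top_of_set {0..})"
    then have "0 \<le> s" by simp
    then show "\<exists>n. n \<in> UNIV \<and> s \<in> {real n..real n + 1} \<and> h s = \<gamma> n (s - real n)"
      by (intro exI[of _ "nat \<lfloor>s\<rfloor>"]) (simp add: h_def; linarith)
  qed
  \<comment> \<open>The substitution \<open>t / (1 - t)\<close> maps \<open>[0, 1)\<close> onto the half-line.\<close>
  define f where "f t = (if t = 1 then y else h (t / (1 - t)))" for t :: real
  have f_cont: "continuous_map (top_of_set {0..<1}) Y f"
  proof (rule continuous_map_eq)
    have "continuous_map (top_of_set {0..<1}) (top_of_set {0..}) (\<lambda>t::real. t / (1 - t))"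
      by (auto intro!: continuous_intros)
    then show "continuous_map (top_of_set {0..<1}) Y (h \<circ> (\<lambda>t. t / (1 - t)))"
      using h_cont by (rule continuous_map_compose)
  qed (simp add: f_def)
  have f_in: "f t \<in> insert y (U 0)" if "t \<in> {0..1}" for t
    using that h_in[of 0 "t / (1 - t)"] by (simp add: f_def)
  have "continuous_map (top_of_set {0..1}) Y f"
    unfolding continuous_map_def
  proof (intro conjI allI impI)
    have "U 0 \<subseteq> topspace Y" by (rule path_connectedin_subset_topspace[OF conn])
    then show "f \<in> topspace (top_of_set {0..1}) \<rightarrow> topspace Y"
      using f_in y by fastforce
    fix V assume V: "openin Y V"
    define S where "S = {t \<in> {0..<1}. f t \<in> V}"
    have "openin (top_of_set {0..<1}) S"
      using openin_continuous_map_preimage[OF f_cont V] by (simp add: S_def)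
    moreover have "openin (top_of_set {0..1}) {0..<1::real}"
      unfolding openin_open by (intro exI[of _ "{..<1}"]) auto
    ultimately have S: "openin (top_of_set {0..1}) S"
      by (rule openin_trans)
    show "openin (top_of_set {0..1}) {t \<in> topspace (top_of_set {0..1}). f t \<in> V}"
    proof (cases "y \<in> V")
      case False
      then have "{t \<in> topspace (top_of_set {0..1}). f t \<in> V} = S"
        by (auto simp: S_def f_def)
      then show ?thesis using S by simp
    next
      case True
      then obtain n where n: "U n \<subseteq> V" using lim[OF V] by blast
      \<comment> \<open>The solution of \<open>r / (1 - r) = n\<close>: beyond it the path stays inside \<open>U n\<close>.\<close>
      define r where "r = real n / (1 + real n)"
      have "f t \<in> V" if "t \<in> {r<..<1}" for t
      proof -
        have "real n \<le> t / (1 - t)"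
          using that by (simp add: r_def field_simps)
        then show ?thesis using h_in n that by (auto simp: f_def)
      qed
      moreover have "0 \<le> r" "r < 1" by (auto simp: r_def)
      ultimately have "{t \<in> topspace (top_of_set {0..1}). f t \<in> V} = S \<union> {r<..1}"
        using True by (auto simp: S_def f_def)
      moreover have "openin (top_of_set {0..1}) {r<..1}"
        unfolding openin_open using \<open>0 \<le> r\<close> by (intro exI[of _ "{r<..}"]) auto
      ultimately show ?thesis using S by auto
    qed
  qed
  then have "pathin (subtopology Y (insert y (U 0))) f"
    using f_in by (simp add: pathin_subtopology) (simp add: pathin_def)
  moreover have "f 0 = x" "f 1 = y"
    using \<gamma>(3)[of 0] z0 by (simp_all add: f_def h_def)
  ultimately show ?thesis
    unfolding path_component_of_def by blast
qed

section \<open>Ends as decreasing families of components\<close>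

lemma path_components_of_eq_q0:
  assumes "C \<in> path_components_of Z" "x \<in> C"
  shows "q0 Z x = C"
  using assms by (auto simp: path_components_of_def path_component_of_equiv)

lemma openin_pi0_singleton:
  assumes C: "C \<in> path_components_of Z" and "openin Z C"
  shows "openin (pi0 Z) {C}"
proof -
  have "{y \<in> topspace Z. q0 Z y \<in> {C}} = C"
    using path_components_of_eq_q0[OF C] path_components_of_subset[OF C] path_component_of_refl
    by fastforce
  then show ?thesis
    using assms by (simp add: openin_pi0)
qed

lemma continuous_map_check_pi0_projection:
  assumes "E \<in> \<epsilon>"
  shows "continuous_map (check_pi0 X \<epsilon>) (pi0 (subtopology X E)) (\<lambda>a. a E)"
  unfolding check_pi0_def
  by (rule continuous_map_from_subtopology[OF continuous_map_product_projection[OF assms]])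

lemma check_pi0_extensional: "a \<in> topspace (check_pi0 X \<epsilon>) \<Longrightarrow> a \<in> extensional \<epsilon>"
  by (auto simp: check_pi0_def PiE_def)

lemma check_pi0_nonempty: "a \<in> topspace (check_pi0 X \<epsilon>) \<Longrightarrow> E \<in> \<epsilon> \<Longrightarrow> a E \<noteq> {}"
  by (metis check_pi0_mem nonempty_path_components_of)

lemma check_pi0_subset: "a \<in> topspace (check_pi0 X \<epsilon>) \<Longrightarrow> E \<in> \<epsilon> \<Longrightarrow> a E \<subseteq> E"
  using check_pi0_mem path_components_of_subset by fastforce

lemma check_pi0_component_mono:
  assumes X: "exterior_space X \<epsilon>" and a: "a \<in> topspace (check_pi0 X \<epsilon>)"
    and E: "E \<in> \<epsilon>" "F \<in> \<epsilon>" "E \<subseteq> F"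
  shows "a E \<subseteq> a F"
proof
  fix x assume x: "x \<in> a E"
  then have "x \<in> E" using check_pi0_subset[OF a E(1)] by blast
  then have "x \<in> q0 (subtopology X F) x"
    using E(3) exterior_space_subset[OF X E(2)] by (auto simp: path_component_of_refl)
  then have "x \<in> pi0_map (subtopology X F) id (a E)"
    using x by (auto simp: pi0_map_def)
  then show "x \<in> a F" by (simp add: check_pi0_mono[OF a E])
qed

text \<open>Compatibility under the maps induced on path components can be checked on the components as
sets: it says that they decrease along with the exterior open sets.\<close>

lemma check_pi0I:
  assumes X: "exterior_space X \<epsilon>"
    and ext: "a \<in> extensional \<epsilon>"
    and comp: "\<And>E. E \<in> \<epsilon> \<Longrightarrow> a E \<in> path_components_of (subtopology X E)"
    and inc: "\<And>E F. E \<in> \<epsilon> \<Longrightarrow> F \<in> \<epsilon> \<Longrightarrow> E \<subseteq> F \<Longrightarrow> a E \<subseteq> a F"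
  shows "a \<in> topspace (check_pi0 X \<epsilon>)"
proof -
  have "pi0_map (subtopology X F) id (a E) = a F" if E: "E \<in> \<epsilon>" "F \<in> \<epsilon>" "E \<subseteq> F" for E F
  proof -
    obtain x where x: "x \<in> a E"
      using comp[OF E(1)] nonempty_path_components_of by blast
    then have "x \<in> E" using path_components_of_subset[OF comp[OF E(1)]] by auto
    with x have "pi0_map (subtopology X F) id (a E) = q0 (subtopology X F) x"
      using pi0_map_q0[OF E(3) exterior_space_subset[OF X E(2)]]
        path_components_of_eq_q0[OF comp[OF E(1)] x] by metis
    also have "\<dots> = a F"
      using path_components_of_eq_q0[OF comp[OF E(2)]] inc[OF E] x by blast
    finally show ?thesis .
  qed
  then show ?thesis
    using comp ext by (auto simp: check_pi0_def topspace_pi0 PiE_iff)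
qed

section \<open>A criterion for completeness\<close>

text \<open>If \<open>e0\<close> is bijective, then the push-out attaches nothing new and collapses nothing, so that
\<open>p0\<close> is a bijection under which \<open>limit_set \<delta>\<close> corresponds to the ideal part. Its inverse is
continuous if \<open>p0\<close> maps open sets to open sets, and of the conditions for openness in the
completion the neighbourhood condition at the end points is the only substantial one; transported
to the limit set, it is the last hypothesis.\<close>

lemma C0_completeI:
  assumes Z: "exterior_space Z \<delta>"
    and bij: "bij_betw (e0 Z \<delta>) (limit_set \<delta>) (topspace (check_pi0 Z \<delta>))"
    and nbhd: "\<And>y W. y \<in> limit_set \<delta> \<Longrightarrow> openin Z W \<Longrightarrow> y \<in> W \<Longrightarrow>
        \<exists>E\<in>\<delta>. \<exists>G. openin (pi0 (subtopology Z E)) G \<and> q0 (subtopology Z E) y \<in> G \<and>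
          (\<forall>x\<in>E. q0 (subtopology Z E) x \<in> G \<longrightarrow> x \<in> W)"
  shows "C0_complete Z \<delta>"
proof -
  let ?p = "p0 Z \<delta>" and ?T = "topspace (check_pi0 Z \<delta>)"
  define g where "g = inv_into (topspace Z) ?p"
  note top = topspace_C0_topology[OF Z]
  have lim_sub: "limit_set \<delta> \<subseteq> E" if "E \<in> \<delta>" for E
    using that by (auto simp: limit_set_def)
  have lim_top: "limit_set \<delta> \<subseteq> topspace Z"
    using exterior_space_nonempty[OF Z] exterior_space_subset[OF Z] lim_sub by blast
  have end_eq: "\<exists>y\<in>limit_set \<delta>. a = e0 Z \<delta> y \<and> in0 Z \<delta> a = ?p y" if "a \<in> ?T" for a
  proof -
    have "a \<in> e0 Z \<delta> ` limit_set \<delta>" using bij that by (simp add: bij_betw_def)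
    then show ?thesis using p0_eq_in0[OF Z] by auto
  qed
  have inj: "inj_on ?p (topspace Z)"
  proof (rule inj_onI)
    fix x y assume "x \<in> topspace Z" "y \<in> topspace Z" "?p x = ?p y"
    from p0_eq_imp[OF this] show "x = y"
      using bij by (auto simp: bij_betw_def dest: inj_onD)
  qed
  have img: "?p ` topspace Z = C0_points Z \<delta>"
  proof
    show "C0_points Z \<delta> \<subseteq> ?p ` topspace Z"
      using end_eq lim_top by (blast elim: C0_points_cases)
  qed (auto intro: p0_in_C0_points)
  have gp: "g (?p x) = x" if "x \<in> topspace Z" for x
    using inj that by (simp add: g_def)
  have pg: "?p (g w) = w" "g w \<in> topspace Z" if "w \<in> C0_points Z \<delta>" for w
    using that unfolding g_def img[symmetric] by (simp_all add: f_inv_into_f inv_into_into)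
  have g_vimage: "{w \<in> C0_points Z \<delta>. g w \<in> W} = ?p ` W" if W: "W \<subseteq> topspace Z" for W
  proof
    show "{w \<in> C0_points Z \<delta>. g w \<in> W} \<subseteq> ?p ` W"
      using pg(1) by (metis (mono_tags, lifting) image_eqI mem_Collect_eq subsetI)
    show "?p ` W \<subseteq> {w \<in> C0_points Z \<delta>. g w \<in> W}"
      using W gp by (auto intro: p0_in_C0_points)
  qed
  have p_open: "C0_open Z \<delta> (?p ` W)" if W: "openin Z W" for W
  proof -
    have Wsub: "W \<subseteq> topspace Z" by (rule openin_subset[OF W])
    have mem: "?p x \<in> ?p ` W \<longleftrightarrow> x \<in> W" if "x \<in> topspace Z" for x
      using inj_on_image_mem_iff[OF inj that Wsub] .
    have local_nbhd: "\<exists>E\<in>\<delta>. \<exists>G. openin (pi0 (subtopology Z E)) G \<and> a E \<in> G \<and>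
           (\<forall>b\<in>?T. b E \<in> G \<longrightarrow> in0 Z \<delta> b \<in> ?p ` W) \<and>
           (\<forall>x\<in>E. q0 (subtopology Z E) x \<in> G \<longrightarrow> ?p x \<in> ?p ` W)"
      if a: "a \<in> ?T" "in0 Z \<delta> a \<in> ?p ` W" for a
    proof -
      obtain y where y: "y \<in> limit_set \<delta>" "a = e0 Z \<delta> y" "in0 Z \<delta> a = ?p y"
        using end_eq[OF a(1)] by blast
      then have "y \<in> W" using a(2) mem lim_top by auto
      then obtain E G where E: "E \<in> \<delta>" and G: "openin (pi0 (subtopology Z E)) G"
          "q0 (subtopology Z E) y \<in> G" "\<And>x. x \<in> E \<Longrightarrow> q0 (subtopology Z E) x \<in> G \<Longrightarrow> x \<in> W"
        using nbhd[OF y(1) W] by blast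
      have "in0 Z \<delta> b \<in> ?p ` W" if b: "b \<in> ?T" "b E \<in> G" for b
      proof -
        obtain z where z: "z \<in> limit_set \<delta>" "b = e0 Z \<delta> z" "in0 Z \<delta> b = ?p z"
          using end_eq[OF b(1)] by blast
        then have "z \<in> W"
          using b(2) E G(3)[of z] lim_sub[OF E] by (auto simp: e0_def)
        then show ?thesis using z(3) by simp
      qed
      moreover have "a E \<in> G" using G(2) E y(2) by (simp add: e0_def)
      ultimately show ?thesis using E G by blast
    qed
    show ?thesis
      unfolding C0_open_def
    proof (intro conjI ballI impI)
      show "?p ` W \<subseteq> C0_points Z \<delta>" using Wsub by (auto intro: p0_in_C0_points)
      have "{x \<in> topspace Z. ?p x \<in> ?p ` W} = W" using mem Wsub by blast
      then show "openin Z {x \<in> topspace Z. ?p x \<in> ?p ` W}" using W by simp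
      \<comment> \<open>The neighbourhood condition already implies openness in the end space, since its sets
        are preimages of open sets under a projection.\<close>
      show "openin (check_pi0 Z \<delta>) {a \<in> ?T. in0 Z \<delta> a \<in> ?p ` W}"
      proof (subst openin_subopen, intro ballI)
        fix a assume "a \<in> {a \<in> ?T. in0 Z \<delta> a \<in> ?p ` W}"
        then have a: "a \<in> ?T" "in0 Z \<delta> a \<in> ?p ` W" by auto
        obtain E G where E: "E \<in> \<delta>" "openin (pi0 (subtopology Z E)) G" "a E \<in> G"
            "\<forall>b\<in>?T. b E \<in> G \<longrightarrow> in0 Z \<delta> b \<in> ?p ` W"
          using local_nbhd[OF a] by blast
        then have "openin (check_pi0 Z \<delta>) {b \<in> ?T. b E \<in> G}"
          using openin_continuous_map_preimage[OF continuous_map_check_pi0_projection] by blast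
        then show "\<exists>S. openin (check_pi0 Z \<delta>) S \<and> a \<in> S \<and> S \<subseteq> {a \<in> ?T. in0 Z \<delta> a \<in> ?p ` W}"
          using E a by (intro exI[of _ "{b \<in> ?T. b E \<in> G}"]) auto
      qed
    qed (rule local_nbhd)
  qed
  have "exterior_map (C0_topology Z \<delta>) (C0_externology Z \<delta>) Z \<delta> g"
    unfolding exterior_map_def continuous_map_def top
  proof (intro conjI ballI allI impI)
    show "g \<in> C0_points Z \<delta> \<rightarrow> topspace Z" using pg(2) by blast
    show "openin (C0_topology Z \<delta>) {w \<in> C0_points Z \<delta>. g w \<in> W}" if "openin Z W" for W
      using p_open[OF that] openin_subset[OF that] by (simp add: g_vimage openin_C0_topology[OF Z])
    fix E assume E: "E \<in> \<delta>"
    \<comment> \<open>Every end point is a limit point, and limit points lie in \<open>E\<close>; so \<open>W0\<close> adds nothing.\<close>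
    have "in0 Z \<delta> ` ?T \<subseteq> ?p ` E" using end_eq lim_sub[OF E] by blast
    then have "?p ` E = W0 Z \<delta> E" by (auto simp: W0_def)
    then show "{w \<in> C0_points Z \<delta>. g w \<in> E} \<in> C0_externology Z \<delta>"
      using E exterior_space_subset[OF Z E] by (simp add: g_vimage C0_externology_def)
  qed
  then show ?thesis
    using Z exterior_map_p0[OF Z] gp pg(1)
    unfolding C0_complete_def exterior_isomorphism_def top by blast
qed

section \<open>Completed components\<close>

text \<open>A point of \<open>X\<close> is glued to at most one end point, so the gluing cannot link two of them.\<close>

lemma in0_eq_imp:
  assumes "a \<in> topspace (check_pi0 X \<epsilon>)" "b \<in> topspace (check_pi0 X \<epsilon>)" "in0 X \<epsilon> a = in0 X \<epsilon> b"
  shows "a = b"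
proof -
  have "(Inr a, Inr b) \<in> glue_rel X \<epsilon>"
    using assms eq_equiv_class[OF _ equiv_glue_rel, of X \<epsilon> "Inr a" "Inr b"]
    unfolding in0_def by (auto simp: Plus_def)
  then have "equivclp (glue X \<epsilon>) (Inr a) (Inr b)" by (simp add: glue_rel_def)
  from glue_no_new_identifications[OF this] show ?thesis by auto
qed

text \<open>If \<open>X\<close> is locally path-connected and first countable at infinity, this is the path component of
\<open>W0 X \<epsilon> E\<close> that extends the path component \<open>C\<close> of \<open>E\<close>.\<close>

definition completed_component ::
  "'a topology \<Rightarrow> 'a set set \<Rightarrow> 'a set \<Rightarrow> 'a set \<Rightarrow> ('a + ('a set \<Rightarrow> 'a set)) set set" where
  "completed_component X \<epsilon> E C =
     p0 X \<epsilon> ` C \<union> in0 X \<epsilon> ` {a \<in> topspace (check_pi0 X \<epsilon>). a E = C}"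

lemma completed_component_cases [consumes 1, case_names point ideal]:
  assumes "w \<in> completed_component X \<epsilon> E C"
  obtains (point) x where "x \<in> C" "w = p0 X \<epsilon> x"
    | (ideal) a where "a \<in> topspace (check_pi0 X \<epsilon>)" "a E = C" "w = in0 X \<epsilon> a"
  using assms unfolding completed_component_def by blast

text \<open>Two distinct points become equal in the completion only if they are limit points with the same
component in every exterior open set. Such points lie in the same component of \<open>E\<close>, so the
identification does not mix different components.\<close>

lemma p0_in_completed_component_iff:
  assumes X: "exterior_space X \<epsilon>" and E: "E \<in> \<epsilon>"
    and C: "C \<in> path_components_of (subtopology X E)" and x: "x \<in> topspace X"
  shows "p0 X \<epsilon> x \<in> completed_component X \<epsilon> E C \<longleftrightarrow> x \<in> C"
proof
  have limit_in_C: "x \<in> C" if "x \<in> limit_set \<epsilon>" "e0 X \<epsilon> x E = C"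
  proof -
    have "x \<in> E" using that(1) E by (auto simp: limit_set_def)
    then have "x \<in> q0 (subtopology X E) x" using x by (simp add: path_component_of_refl)
    moreover have "q0 (subtopology X E) x = C" using that(2) E by (simp add: e0_def)
    ultimately show ?thesis by blast
  qed
  assume "p0 X \<epsilon> x \<in> completed_component X \<epsilon> E C"
  then show "x \<in> C"
  proof (cases rule: completed_component_cases)
    case (point z)
    have "z \<in> topspace X" using path_components_of_subset[OF C] point(1) by auto
    then consider "x = z" | "x \<in> limit_set \<epsilon>" "e0 X \<epsilon> x = e0 X \<epsilon> z"
      using p0_eq_imp[OF x _ point(2)] by blast
    then show ?thesis
    proof cases
      case 2
      have "e0 X \<epsilon> z E = C"
        using path_components_of_eq_q0[OF C point(1)] E by (simp add: e0_def)
      then show ?thesis using 2 limit_in_C by simp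
    qed (simp add: point(1))
  next
    case (ideal a)
    then show ?thesis using p0_eq_in0_imp[OF x ideal(1,3)] limit_in_C by blast
  qed
qed (simp add: completed_component_def)

lemma in0_in_completed_component_iff:
  assumes E: "E \<in> \<epsilon>" and C: "C \<in> path_components_of (subtopology X E)"
    and a: "a \<in> topspace (check_pi0 X \<epsilon>)"
  shows "in0 X \<epsilon> a \<in> completed_component X \<epsilon> E C \<longleftrightarrow> a E = C"
proof
  assume "in0 X \<epsilon> a \<in> completed_component X \<epsilon> E C"
  then show "a E = C"
  proof (cases rule: completed_component_cases)
    case (point x)
    have "x \<in> topspace X" using path_components_of_subset[OF C] point(1) by auto
    then have "e0 X \<epsilon> x = a" using p0_eq_in0_imp[OF _ a point(2)[symmetric]] by blast
    then show ?thesis using path_components_of_eq_q0[OF C point(1)] E by (auto simp: e0_def)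
  next
    case (ideal b)
    then show ?thesis using in0_eq_imp[OF a] by blast
  qed
qed (use a in \<open>auto simp: completed_component_def\<close>)

lemma openin_W0:
  assumes "exterior_space X \<epsilon>" "E \<in> \<epsilon>"
  shows "openin (C0_topology X \<epsilon>) (W0 X \<epsilon> E)"
  using C0_open_W0[OF assms] by (simp add: openin_C0_topology[OF assms(1)])

lemma topspace_subtopology_W0:
  assumes "exterior_space X \<epsilon>" "E \<in> \<epsilon>"
  shows "topspace (subtopology (C0_topology X \<epsilon>) (W0 X \<epsilon> E)) = W0 X \<epsilon> E"
  using openin_subset[OF openin_W0[OF assms]] by auto

lemma W0_eq_Union_completed_components:
  assumes X: "exterior_space X \<epsilon>" and E: "E \<in> \<epsilon>"
  shows "W0 X \<epsilon> E = \<Union> (completed_component X \<epsilon> E ` path_components_of (subtopology X E))"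
proof
  show "W0 X \<epsilon> E \<subseteq> \<Union> (completed_component X \<epsilon> E ` path_components_of (subtopology X E))"
  proof
    fix w assume "w \<in> W0 X \<epsilon> E"
    then consider (point) x where "x \<in> E" "w = p0 X \<epsilon> x"
      | (ideal) a where "a \<in> topspace (check_pi0 X \<epsilon>)" "w = in0 X \<epsilon> a"
      unfolding W0_def by blast
    then show "w \<in> \<Union> (completed_component X \<epsilon> E ` path_components_of (subtopology X E))"
    proof cases
      case point
      have "x \<in> \<Union> (path_components_of (subtopology X E))"
        using point(1) exterior_space_subset[OF X E] by (auto simp: Union_path_components_of)
      then show ?thesis using point(2) by (auto simp: completed_component_def)
    next
      case ideal
      then show ?thesis
        using check_pi0_mem[OF ideal(1) E] by (auto simp: completed_component_def)
    qed
  qed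
  show "\<Union> (completed_component X \<epsilon> E ` path_components_of (subtopology X E)) \<subseteq> W0 X \<epsilon> E"
    using path_components_of_subset[of _ "subtopology X E"]
    by (fastforce simp: completed_component_def W0_def)
qed

lemma completed_component_inject:
  assumes X: "exterior_space X \<epsilon>" and E: "E \<in> \<epsilon>"
    and C: "C \<in> path_components_of (subtopology X E)" "w \<in> completed_component X \<epsilon> E C"
    and D: "D \<in> path_components_of (subtopology X E)" "w \<in> completed_component X \<epsilon> E D"
  shows "C = D"
  using C(2)
proof (cases rule: completed_component_cases)
  case (point x)
  have "x \<in> topspace X" using path_components_of_subset[OF C(1)] point(1) by auto
  then have "x \<in> D"
    using D point(2) p0_in_completed_component_iff[OF X E D(1)] by simp
  then show ?thesis
    using path_components_of_eq_q0[OF C(1) point(1)] path_components_of_eq_q0[OF D(1)] by blast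
next
  case (ideal a)
  then show ?thesis using D in0_in_completed_component_iff[OF E D(1)] by simp
qed

text \<open>This is where local path-connectedness enters: the components of the open set \<open>E\<close> are open, so
\<open>pi0\<close> of \<open>E\<close> is discrete, and the singleton of \<open>C\<close> serves as the open set demanded by the
neighbourhood condition at every end point that passes through \<open>C\<close>.\<close>

lemma openin_completed_component:
  assumes X: "exterior_space X \<epsilon>" and lpc: "locally_path_connected_space X"
    and E: "E \<in> \<epsilon>" and C: "C \<in> path_components_of (subtopology X E)"
  shows "openin (C0_topology X \<epsilon>) (completed_component X \<epsilon> E C)"
proof -
  let ?K = "completed_component X \<epsilon> E C" and ?T = "topspace (check_pi0 X \<epsilon>)"
  note oE = exterior_space_openin[OF X E]
  have Csub: "C \<subseteq> E" "C \<subseteq> topspace X"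
    using path_components_of_subset[OF C] by auto
  note pmem = p0_in_completed_component_iff[OF X E C] and imem = in0_in_completed_component_iff[OF E C]
  have openC: "openin X C"
    using lpc oE C locally_path_connected_space_open_path_components by metis
  then have oC: "openin (pi0 (subtopology X E)) {C}"
    using Csub(1) by (intro openin_pi0_singleton[OF C]) (simp add: openin_open_subtopology[OF oE])
  have "C0_open X \<epsilon> ?K"
    unfolding C0_open_def
  proof (intro conjI ballI impI)
    show "?K \<subseteq> C0_points X \<epsilon>"
      using Csub by (auto simp: completed_component_def intro: p0_in_C0_points in0_in_C0_points)
    have "{x \<in> topspace X. p0 X \<epsilon> x \<in> ?K} = C"
      using pmem Csub by blast
    then show "openin X {x \<in> topspace X. p0 X \<epsilon> x \<in> ?K}"
      using openC by simp
    have "{a \<in> ?T. in0 X \<epsilon> a \<in> ?K} = {a \<in> ?T. a E \<in> {C}}"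
      using imem by blast
    then show "openin (check_pi0 X \<epsilon>) {a \<in> ?T. in0 X \<epsilon> a \<in> ?K}"
      using openin_continuous_map_preimage[OF continuous_map_check_pi0_projection[OF E] oC] by metis
    fix a assume "a \<in> ?T" "in0 X \<epsilon> a \<in> ?K"
    then have "a E = C" using imem by blast
    moreover have "p0 X \<epsilon> x \<in> ?K" if "x \<in> E" "q0 (subtopology X E) x = C" for x
    proof -
      have "x \<in> topspace X" using that(1) exterior_space_subset[OF X E] by blast
      then have "x \<in> q0 (subtopology X E) x" using that(1) by (simp add: path_component_of_refl)
      then show ?thesis using that(2) by (simp add: completed_component_def)
    qed
    ultimately show "\<exists>E\<in>\<epsilon>. \<exists>G. openin (pi0 (subtopology X E)) G \<and> a E \<in> G \<and>
           (\<forall>b\<in>?T. b E \<in> G \<longrightarrow> in0 X \<epsilon> b \<in> ?K) \<and>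
           (\<forall>x\<in>E. q0 (subtopology X E) x \<in> G \<longrightarrow> p0 X \<epsilon> x \<in> ?K)"
      using E oC imem by (intro bexI[of _ E] exI[of _ "{C}"]) auto
  qed
  then show ?thesis by (simp add: openin_C0_topology[OF X])
qed

section \<open>Paths to end points\<close>

text \<open>Starting the base at \<open>E\<close> itself lets a path to an end point begin anywhere in the component
of \<open>E\<close> that the end selects.\<close>

lemma decseq_base_below:
  assumes X: "exterior_space X \<epsilon>" and fc: "first_countable_at_infinity \<epsilon>" and E: "E \<in> \<epsilon>"
  obtains D where "D 0 = E" "\<And>n. D n \<in> \<epsilon>" "decseq D" "\<And>F. F \<in> \<epsilon> \<Longrightarrow> \<exists>n. D n \<subseteq> F"
proof -
  obtain B where B: "\<And>n. B n \<in> \<epsilon>" "\<And>n. B (Suc n) \<subseteq> B n" "\<And>F. F \<in> \<epsilon> \<Longrightarrow> \<exists>n::nat. B n \<subseteq> F"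
    using fc unfolding first_countable_at_infinity_def by blast
  define D where "D n = (case n of 0 \<Rightarrow> E | Suc k \<Rightarrow> E \<inter> B k)" for n
  show thesis
  proof (rule that)
    show "D 0 = E" by (simp add: D_def)
    show "D n \<in> \<epsilon>" for n
      using E B(1) exterior_space_Int[OF X] by (simp add: D_def split: nat.split)
    show "decseq D"
      using B(2) by (intro decseq_SucI) (auto simp: D_def split: nat.split)
    show "\<exists>n. D n \<subseteq> F" if F: "F \<in> \<epsilon>" for F
    proof -
      obtain k where "B k \<subseteq> F" using B(3)[OF F] by blast
      then have "D (Suc k) \<subseteq> F" by (auto simp: D_def)
      then show ?thesis by blast
    qed
  qed
qed

text \<open>This is where first countability enters: an end point is the limit of the components that it
selects along a countable base, and these shrink to it in the completion, so a path can run from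
the first of them to the end point.\<close>

lemma path_component_of_p0_in0:
  assumes X: "exterior_space X \<epsilon>" and fc: "first_countable_at_infinity \<epsilon>" and E: "E \<in> \<epsilon>"
    and a: "a \<in> topspace (check_pi0 X \<epsilon>)" and x: "x \<in> a E"
  shows "path_component_of (subtopology (C0_topology X \<epsilon>) (insert (in0 X \<epsilon> a) (p0 X \<epsilon> ` a E)))
           (p0 X \<epsilon> x) (in0 X \<epsilon> a)"
proof -
  obtain D where D: "D 0 = E" "\<And>n. D n \<in> \<epsilon>" "decseq D" "\<And>F. F \<in> \<epsilon> \<Longrightarrow> \<exists>n. D n \<subseteq> F"
    using decseq_base_below[OF X fc E] by blast
  have "path_component_of
      (subtopology (C0_topology X \<epsilon>) (insert (in0 X \<epsilon> a) ((\<lambda>n. p0 X \<epsilon> ` a (D n)) 0)))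
      (p0 X \<epsilon> x) (in0 X \<epsilon> a)"
  proof (rule path_component_of_limit)
    show "path_connectedin (C0_topology X \<epsilon>) (p0 X \<epsilon> ` a (D n))" for n
    proof (rule path_connectedin_continuous_map_image)
      show "continuous_map X (C0_topology X \<epsilon>) (p0 X \<epsilon>)"
        using exterior_map_p0[OF X] by (simp add: exterior_map_def)
      show "path_connectedin X (a (D n))"
        using path_connectedin_path_components_of[OF check_pi0_mem[OF a D(2)]]
        by (simp add: path_connectedin_subtopology)
    qed
    show "p0 X \<epsilon> ` a (D n) \<noteq> {}" for n
      using check_pi0_nonempty[OF a D(2)] by simp
    show "decseq (\<lambda>n. p0 X \<epsilon> ` a (D n))"
      using check_pi0_component_mono[OF X a D(2) D(2)] decseq_SucD[OF D(3)]
      by (intro decseq_SucI image_mono) blast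
    show "in0 X \<epsilon> a \<in> topspace (C0_topology X \<epsilon>)"
      using in0_in_C0_points[OF a] by (simp add: topspace_C0_topology[OF X])
    show "p0 X \<epsilon> x \<in> p0 X \<epsilon> ` a (D 0)" using x D(1) by simp
    fix V assume "openin (C0_topology X \<epsilon>) V" and V: "in0 X \<epsilon> a \<in> V"
    then have "C0_open X \<epsilon> V" by (simp add: openin_C0_topology[OF X])
    from C0_open_nbhd[OF this a V] obtain F G where F: "F \<in> \<epsilon>" "a F \<in> G"
        "\<And>x. x \<in> F \<Longrightarrow> q0 (subtopology X F) x \<in> G \<Longrightarrow> p0 X \<epsilon> x \<in> V"
      by metis
    obtain n where n: "D n \<subseteq> F" using D(4)[OF F(1)] by blast
    have "p0 X \<epsilon> z \<in> V" if "z \<in> a (D n)" for z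
    proof (rule F(3))
      have "z \<in> a F" using check_pi0_component_mono[OF X a D(2) F(1) n] that by blast
      then show "z \<in> F" "q0 (subtopology X F) z \<in> G"
        using check_pi0_subset[OF a F(1)] F(2)
          path_components_of_eq_q0[OF check_pi0_mem[OF a F(1)], of z] by auto
    qed
    then show "\<exists>n. p0 X \<epsilon> ` a (D n) \<subseteq> V" by blast
  qed
  then show ?thesis by (simp only: D(1))
qed

lemma path_connectedin_completed_component:
  assumes X: "exterior_space X \<epsilon>" and fc: "first_countable_at_infinity \<epsilon>" and E: "E \<in> \<epsilon>"
    and C: "C \<in> path_components_of (subtopology X E)"
  shows "path_connectedin (C0_topology X \<epsilon>) (completed_component X \<epsilon> E C)"
proof -
  let ?Y = "C0_topology X \<epsilon>" and ?K = "completed_component X \<epsilon> E C"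
  have "C \<subseteq> topspace X" using path_components_of_subset[OF C] by auto
  then have Ksub: "?K \<subseteq> topspace ?Y"
    by (auto simp: completed_component_def topspace_C0_topology[OF X]
        intro: p0_in_C0_points in0_in_C0_points)
  obtain x where x: "x \<in> C" using nonempty_path_components_of[OF C] by blast
  have conn: "path_component_of (subtopology ?Y ?K) (p0 X \<epsilon> x) w" if "w \<in> ?K" for w
    using that
  proof (cases rule: completed_component_cases)
    case (point z)
    have "path_connectedin ?Y (p0 X \<epsilon> ` C)"
    proof (rule path_connectedin_continuous_map_image)
      show "continuous_map X ?Y (p0 X \<epsilon>)"
        using exterior_map_p0[OF X] by (simp add: exterior_map_def)
      show "path_connectedin X C"
        using path_connectedin_path_components_of[OF C] by (simp add: path_connectedin_subtopology)
    qed
    moreover have "p0 X \<epsilon> ` C \<subseteq> ?K" by (simp add: completed_component_def)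
    ultimately have "path_connectedin (subtopology ?Y ?K) (p0 X \<epsilon> ` C)"
      by (simp add: path_connectedin_subtopology)
    then show ?thesis using x point by (auto simp: path_component_of)
  next
    case (ideal a)
    have "insert (in0 X \<epsilon> a) (p0 X \<epsilon> ` a E) \<subseteq> ?K"
      using ideal by (auto simp: completed_component_def)
    then show ?thesis
      using path_component_of_p0_in0[OF X fc E ideal(1)] x ideal(2,3)
      by (metis path_component_of_mono)
  qed
  have "path_connected_space (subtopology ?Y ?K)"
    unfolding path_connected_space_iff_path_component
  proof (intro ballI)
    fix v w assume "v \<in> topspace (subtopology ?Y ?K)" "w \<in> topspace (subtopology ?Y ?K)"
    then have "v \<in> ?K" "w \<in> ?K" by auto
    then show "path_component_of (subtopology ?Y ?K) v w"
      using conn by (meson path_component_of_sym path_component_of_trans)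
  qed
  then show ?thesis using Ksub by (simp add: path_connectedin_def)
qed

text \<open>The completed components partition \<open>W0 X \<epsilon> E\<close> into open sets; so each of them is also closed
in it, and being path-connected it is a path component.\<close>

lemma q0_W0_eq_completed_component:
  assumes X: "exterior_space X \<epsilon>" and lpc: "locally_path_connected_space X"
    and fc: "first_countable_at_infinity \<epsilon>" and E: "E \<in> \<epsilon>"
    and C: "C \<in> path_components_of (subtopology X E)" and w: "w \<in> completed_component X \<epsilon> E C"
  shows "q0 (subtopology (C0_topology X \<epsilon>) (W0 X \<epsilon> E)) w = completed_component X \<epsilon> E C"
proof (rule path_component_of_set_eq_clopen[OF _ _ _ w])
  let ?Y = "C0_topology X \<epsilon>" and ?P = "path_components_of (subtopology X E)"
  let ?K = "completed_component X \<epsilon> E"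
  note oW = openin_W0[OF X E] and topW = topspace_subtopology_W0[OF X E]
  note W0_eq = W0_eq_Union_completed_components[OF X E]
  have sub: "?K D \<subseteq> W0 X \<epsilon> E" if "D \<in> ?P" for D
    using that W0_eq by blast
  have op: "openin (subtopology ?Y (W0 X \<epsilon> E)) (?K D)" if "D \<in> ?P" for D
    using openin_completed_component[OF X lpc E that] sub[OF that]
    by (simp add: openin_open_subtopology[OF oW])
  show "openin (subtopology ?Y (W0 X \<epsilon> E)) (?K C)" by (rule op[OF C])
  show "closedin (subtopology ?Y (W0 X \<epsilon> E)) (?K C)"
    unfolding closedin_def topW
  proof
    have "W0 X \<epsilon> E - ?K C = \<Union> (?K ` (?P - {C}))"
      using completed_component_inject[OF X E C] C unfolding W0_eq by blast
    then show "openin (subtopology ?Y (W0 X \<epsilon> E)) (W0 X \<epsilon> E - ?K C)"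
      using op by auto
  qed (rule sub[OF C])
  show "path_connectedin (subtopology ?Y (W0 X \<epsilon> E)) (?K C)"
    using path_connectedin_completed_component[OF X fc E C] sub[OF C]
    by (simp add: path_connectedin_subtopology)
qed

lemma path_components_of_W0:
  assumes X: "exterior_space X \<epsilon>" and lpc: "locally_path_connected_space X"
    and fc: "first_countable_at_infinity \<epsilon>" and E: "E \<in> \<epsilon>"
  shows "path_components_of (subtopology (C0_topology X \<epsilon>) (W0 X \<epsilon> E)) =
    completed_component X \<epsilon> E ` path_components_of (subtopology X E)"
proof -
  let ?Z = "subtopology (C0_topology X \<epsilon>) (W0 X \<epsilon> E)"
  note topW = topspace_subtopology_W0[OF X E]
  note q = q0_W0_eq_completed_component[OF X lpc fc E]
  have "completed_component X \<epsilon> E C \<in> q0 ?Z ` W0 X \<epsilon> E"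
    if C: "C \<in> path_components_of (subtopology X E)" for C
  proof -
    obtain x where "x \<in> C" using nonempty_path_components_of[OF C] by blast
    then have x: "p0 X \<epsilon> x \<in> completed_component X \<epsilon> E C" by (simp add: completed_component_def)
    then have "p0 X \<epsilon> x \<in> W0 X \<epsilon> E"
      using C W0_eq_Union_completed_components[OF X E] by blast
    then show ?thesis using q[OF C x] by blast
  qed
  moreover have "q0 ?Z w \<in> completed_component X \<epsilon> E ` path_components_of (subtopology X E)"
    if "w \<in> W0 X \<epsilon> E" for w
    using that q W0_eq_Union_completed_components[OF X E] by (metis UN_E imageI)
  ultimately show ?thesis
    unfolding path_components_of_def[of ?Z] topW by blast
qed

section \<open>The ends of the completion\<close>

text \<open>A point \<open>p0 X \<epsilon> x\<close> lies in every \<open>W0 X \<epsilon> E\<close> only if \<open>x\<close> is a limit point of \<open>X\<close>, and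
then it has been glued to an end point.\<close>

lemma limit_set_C0:
  assumes X: "exterior_space X \<epsilon>"
  shows "limit_set (C0_externology X \<epsilon>) = in0 X \<epsilon> ` topspace (check_pi0 X \<epsilon>)"
proof
  show "in0 X \<epsilon> ` topspace (check_pi0 X \<epsilon>) \<subseteq> limit_set (C0_externology X \<epsilon>)"
    by (auto simp: limit_set_def C0_externology_def W0_def)
  show "limit_set (C0_externology X \<epsilon>) \<subseteq> in0 X \<epsilon> ` topspace (check_pi0 X \<epsilon>)"
  proof
    fix w assume "w \<in> limit_set (C0_externology X \<epsilon>)"
    then have w: "w \<in> W0 X \<epsilon> E" if "E \<in> \<epsilon>" for E
      using that by (auto simp: limit_set_def C0_externology_def)
    obtain E where E: "E \<in> \<epsilon>" using exterior_space_nonempty[OF X] by blast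
    from w[OF E] consider (point) x where "x \<in> E" "w = p0 X \<epsilon> x"
      | (ideal) "w \<in> in0 X \<epsilon> ` topspace (check_pi0 X \<epsilon>)"
      unfolding W0_def by blast
    then show "w \<in> in0 X \<epsilon> ` topspace (check_pi0 X \<epsilon>)"
    proof cases
      case point
      have "x \<in> F" if F: "F \<in> \<epsilon>" for F
        using p0_vimage_W0[OF X F] w[OF F] point exterior_space_subset[OF X E] by blast
      then have x: "x \<in> limit_set \<epsilon>" by (simp add: limit_set_def)
      then show ?thesis using point(2) p0_eq_in0[OF X x] e0_in_check_pi0[OF X x] by simp
    qed
  qed
qed

text \<open>Completing the components is a natural bijection from the path components of \<open>E\<close> to those of
\<open>W0 X \<epsilon> E\<close>; so \<open>X\<close> and its completion have the same end space. Under this identification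
\<open>e0\<close> of the completion is inverse to \<open>in0\<close>.\<close>

lemma bij_betw_e0_C0:
  assumes X: "exterior_space X \<epsilon>" and lpc: "locally_path_connected_space X"
    and fc: "first_countable_at_infinity \<epsilon>"
  shows "bij_betw (e0 (C0_topology X \<epsilon>) (C0_externology X \<epsilon>)) (limit_set (C0_externology X \<epsilon>))
    (topspace (check_pi0 (C0_topology X \<epsilon>) (C0_externology X \<epsilon>)))"
proof -
  let ?Y = "C0_topology X \<epsilon>" and ?\<delta> = "C0_externology X \<epsilon>"
  let ?T = "topspace (check_pi0 X \<epsilon>)" and ?K = "completed_component X \<epsilon>"
  note Y = exterior_space_C0[OF X]
  have W: "W0 X \<epsilon> E \<in> ?\<delta>" if "E \<in> \<epsilon>" for E
    using that by (simp add: C0_externology_def)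
  have in0_mem: "in0 X \<epsilon> a \<in> ?K E (a E)" if "a \<in> ?T" for a E
    using that by (auto simp: completed_component_def)
  have e0_in0: "e0 ?Y ?\<delta> (in0 X \<epsilon> a) (W0 X \<epsilon> E) = ?K E (a E)" if "a \<in> ?T" "E \<in> \<epsilon>" for a E
    using q0_W0_eq_completed_component[OF X lpc fc that(2) check_pi0_mem[OF that] in0_mem[OF that(1)]]
      W[OF that(2)] by (simp add: e0_def)
  have inj: "a = b" if ab: "a \<in> ?T" "b \<in> ?T" "e0 ?Y ?\<delta> (in0 X \<epsilon> a) = e0 ?Y ?\<delta> (in0 X \<epsilon> b)" for a b
  proof (rule extensionalityI)
    fix E assume E: "E \<in> \<epsilon>"
    have "?K E (a E) = ?K E (b E)"
      using ab e0_in0 E by metis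
    then show "a E = b E"
      using in0_in_completed_component_iff[OF E check_pi0_mem[OF ab(2) E] ab(1)] in0_mem[OF ab(1)]
      by blast
  qed (use ab check_pi0_extensional in auto)
  have surj: "c \<in> e0 ?Y ?\<delta> ` in0 X \<epsilon> ` ?T" if c: "c \<in> topspace (check_pi0 ?Y ?\<delta>)" for c
  proof -
    \<comment> \<open>The end of \<open>X\<close> obtained from \<open>c\<close> by discarding the ideal points of its components.\<close>
    define a where "a = (\<lambda>E\<in>\<epsilon>. {x \<in> topspace X. p0 X \<epsilon> x \<in> c (W0 X \<epsilon> E)})"
    have a: "a E \<in> path_components_of (subtopology X E)" "c (W0 X \<epsilon> E) = ?K E (a E)" if E: "E \<in> \<epsilon>" for E
    proof -
      obtain C where C: "C \<in> path_components_of (subtopology X E)" "c (W0 X \<epsilon> E) = ?K E C"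
        using check_pi0_mem[OF c W[OF E]] path_components_of_W0[OF X lpc fc E] by auto
      have "C \<subseteq> topspace X" using path_components_of_subset[OF C(1)] by auto
      then have "a E = C"
        using p0_in_completed_component_iff[OF X E C(1)] E by (auto simp: a_def C(2))
      then show "a E \<in> path_components_of (subtopology X E)" "c (W0 X \<epsilon> E) = ?K E (a E)"
        using C by auto
    qed
    have aT: "a \<in> ?T"
    proof (rule check_pi0I[OF X _ a(1)])
      show "a \<in> extensional \<epsilon>" by (simp add: a_def)
      fix E F assume EF: "E \<in> \<epsilon>" "F \<in> \<epsilon>" "E \<subseteq> F"
      then have "W0 X \<epsilon> E \<subseteq> W0 X \<epsilon> F" by (auto simp: W0_def)
      then have "c (W0 X \<epsilon> E) \<subseteq> c (W0 X \<epsilon> F)"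
        by (rule check_pi0_component_mono[OF Y c W[OF EF(1)] W[OF EF(2)]])
      then show "a E \<subseteq> a F" using EF by (auto simp: a_def)
    qed
    have "c = e0 ?Y ?\<delta> (in0 X \<epsilon> a)"
    proof (rule extensionalityI[OF check_pi0_extensional[OF c]])
      show "e0 ?Y ?\<delta> (in0 X \<epsilon> a) \<in> extensional ?\<delta>" by (simp add: e0_def)
      fix V assume "V \<in> ?\<delta>"
      then obtain E where "E \<in> \<epsilon>" "V = W0 X \<epsilon> E" by (auto simp: C0_externology_def)
      then show "c V = e0 ?Y ?\<delta> (in0 X \<epsilon> a) V" using e0_in0[OF aT] a(2) by simp
    qed
    then show ?thesis using aT by blast
  qed
  show ?thesis
    unfolding bij_betw_def
  proof
    show "inj_on (e0 ?Y ?\<delta>) (limit_set ?\<delta>)"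
      using inj unfolding limit_set_C0[OF X] by (intro inj_onI) blast
    show "e0 ?Y ?\<delta> ` limit_set ?\<delta> = topspace (check_pi0 ?Y ?\<delta>)"
      using surj e0_in_check_pi0[OF Y] unfolding limit_set_C0[OF X] by blast
  qed
qed

theorem theorem3p3:
  fixes X :: "'a topology" and \<epsilon> :: "'a set set"
  assumes "exterior_space X \<epsilon>"
    and "locally_path_connected_space X"
    and "first_countable_at_infinity \<epsilon>"
  shows "C0_complete (C0_topology X \<epsilon>) (C0_externology X \<epsilon>)"
proof (rule C0_completeI)
  let ?Y = "C0_topology X \<epsilon>" and ?\<delta> = "C0_externology X \<epsilon>"
  note X = assms(1)
  show "exterior_space ?Y ?\<delta>" by (rule exterior_space_C0[OF X])
  show "bij_betw (e0 ?Y ?\<delta>) (limit_set ?\<delta>) (topspace (check_pi0 ?Y ?\<delta>))"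
    by (rule bij_betw_e0_C0[OF assms])
  fix y V assume y: "y \<in> limit_set ?\<delta>" and V: "openin ?Y V" "y \<in> V"
  obtain a where a: "a \<in> topspace (check_pi0 X \<epsilon>)" "y = in0 X \<epsilon> a"
    using y limit_set_C0[OF X] by blast
  have "C0_open X \<epsilon> V" "in0 X \<epsilon> a \<in> V"
    using V a(2) by (simp_all add: openin_C0_topology[OF X])
  then obtain E G where E: "E \<in> \<epsilon>" "a E \<in> G"
      "\<And>b. b \<in> topspace (check_pi0 X \<epsilon>) \<Longrightarrow> b E \<in> G \<Longrightarrow> in0 X \<epsilon> b \<in> V"
      "\<And>x. x \<in> E \<Longrightarrow> q0 (subtopology X E) x \<in> G \<Longrightarrow> p0 X \<epsilon> x \<in> V"
    using C0_open_nbhd[OF _ a(1)] by metis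
  \<comment> \<open>The completed component at \<open>a\<close> is contained in \<open>V\<close>, because the open set \<open>G\<close> contains \<open>a E\<close>;
    so its singleton is the open set of path components to use.\<close>
  let ?K = "completed_component X \<epsilon> E (a E)" and ?Z = "subtopology ?Y (W0 X \<epsilon> E)"
  note aE = check_pi0_mem[OF a(1) E(1)]
  have yK: "y \<in> ?K" using a by (auto simp: completed_component_def)
  have KV: "?K \<subseteq> V"
    using E check_pi0_subset[OF a(1) E(1)] path_components_of_eq_q0[OF aE]
    by (auto simp: completed_component_def)
  have refl: "w \<in> q0 ?Z w" if "w \<in> W0 X \<epsilon> E" for w
    using that topspace_subtopology_W0[OF X E(1)]
    by (simp add: path_component_of_refl del: topspace_subtopology)
  have KW: "?K \<subseteq> W0 X \<epsilon> E" using W0_eq_Union_completed_components[OF X E(1)] aE by blast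
  note qK = q0_W0_eq_completed_component[OF assms E(1) aE]
  have "openin ?Z ?K"
    using openin_completed_component[OF X assms(2) E(1) aE] KW
    by (metis inf.absorb_iff1 openin_subtopology_Int)
  then have "openin (pi0 ?Z) {?K}"
    using path_components_of_W0[OF assms E(1)] aE by (simp add: openin_pi0_singleton)
  moreover have "w \<in> V" if "w \<in> W0 X \<epsilon> E" "q0 ?Z w \<in> {?K}" for w
    using refl[OF that(1)] that(2) KV by blast
  moreover have "W0 X \<epsilon> E \<in> ?\<delta>" using E(1) by (simp add: C0_externology_def)
  ultimately show "\<exists>E\<in>?\<delta>. \<exists>G. openin (pi0 (subtopology ?Y E)) G \<and> q0 (subtopology ?Y E) y \<in> G \<and>
          (\<forall>x\<in>E. q0 (subtopology ?Y E) x \<in> G \<longrightarrow> x \<in> V)"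
    using qK[OF yK] by (intro bexI[of _ "W0 X \<epsilon> E"] exI[of _ "{?K}"]) auto
qed

end
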